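(* Let $\mathcal{F}$ be an invertible iterated function system on a compact metric space $\mathbb{X}$. Let $\mathcal{U}$ denote the set of all Conley attractors of $\mathcal{F}$ and let $\mathcal{R}$ denote the set of chain-recurrent points of $\mathcal{F}$. Then $$\mathcal{R}=\bigcap_{A\in\mathcal{U}} \left( A \cup A^{*}\right),$$ where $A^{*}$ is the dual repeller of $A$.
   Context: An iterated function system (IFS) $\mathcal{F} = (\mathbb{X}; f_1,\dots,f_N)$ on a metric space $(\mathbb{X},d)$ is a finite collection of continuous functions $f_n : \mathbb{X}\to\mathbb{X}$, $n=1,\dots,N$. It is invertible if every $f_n$ is a homeomorphism of $\mathbb{X}$. The same symbol denotes the map on subsets $\mathcal{F}(S) = \bigcup_{f\in\mathcal{F}} f(S)$, and $\mathcal{F}^k$ is its $k$-fold composition. A compact set $A\subset\mathbb{X}$ is a Conley attractor of $\mathcal{F}$ if there is an open set $U$ with $A\subset U$ and $A=\lim_{k\to\infty}\mathcal{F}^k(\overline{U})$ in the Hausdorff metric. The basin $B$ of $A$ is the union of all open sets $U$ with this property. The empty set is allowed as a Conley attractor (with $U=\emptyset$ and basin $\emptyset$; a sequence of sets converges to $\emptyset$ only if the sets are eventually empty). The dual repeller of a Conley attractor $A$ with basin $B$ is $A^{*}:=\mathbb{X}\setminus B$. For $\varepsilon>0$, an $\varepsilon$-chain for $\mathcal{F}$ is a finite sequence of points $\{x_i\}_{i=0}^{n}$, $n>0$, in $\mathbb{X}$ such that for each $i\in\{0,1,\dots,n-1\}$ there is an $f\in\mathcal{F}$ with $d(x_{i+1},f(x_i))<\varepsilon$.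 A point $x\in\mathbb{X}$ is chain-recurrent for $\mathcal{F}$ if for every $\varepsilon>0$ there is an $\varepsilon$-chain $\{x_i\}_{i=0}^{n}$ for $\mathcal{F}$ with $x_0=x_n=x$. *)

theory Defs
  imports "HOL-Analysis.Analysis"
begin

definition ifs :: "('a::metric_space \<Rightarrow> 'a) set \<Rightarrow> bool" where
  "ifs F \<longleftrightarrow> finite F \<and> (\<forall>f\<in>F. continuous_on UNIV f)"

definition invertible_ifs :: "('a::metric_space \<Rightarrow> 'a) set \<Rightarrow> bool" where
  "invertible_ifs F \<longleftrightarrow> ifs F \<and> (\<forall>f\<in>F. \<exists>g. homeomorphism UNIV UNIV f g)"

definition ifs_map :: "('a \<Rightarrow> 'a) set \<Rightarrow> 'a set \<Rightarrow> 'a set" where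
  "ifs_map F S = (\<Union>f\<in>F. f ` S)"

(* The Hausdorff distance; meaningful only for nonempty bounded sets. *)
definition hausdorff_dist :: "'a::metric_space set \<Rightarrow> 'a set \<Rightarrow> real" where
  "hausdorff_dist S T = max (SUP x\<in>S. infdist x T) (SUP y\<in>T. infdist y S)"

(* Convergence in the Hausdorff metric, with the empty set treated as an isolated
   point of the hyperspace: only eventually empty sequences converge to it, and a
   sequence converging to a nonempty set is eventually nonempty. *)
definition hausdorff_limit :: "(nat \<Rightarrow> 'a::metric_space set) \<Rightarrow> 'a set \<Rightarrow> bool" where
  "hausdorff_limit S A \<longleftrightarrow>
     (if A = {} then (\<forall>\<^sub>F k in sequentially. S k = {})
      else (\<forall>\<^sub>F k in sequentially. S k \<noteq> {}) \<and> (\<lambda>k. hausdorff_dist (S k) A) \<longlonglongrightarrow> 0)"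

definition attracts_nbhd :: "('a::metric_space \<Rightarrow> 'a) set \<Rightarrow> 'a set \<Rightarrow> 'a set \<Rightarrow> bool" where
  "attracts_nbhd F A U \<longleftrightarrow>
     open U \<and> A \<subseteq> U \<and> hausdorff_limit (\<lambda>k. (ifs_map F ^^ k) (closure U)) A"

definition conley_attractor :: "('a::metric_space \<Rightarrow> 'a) set \<Rightarrow> 'a set \<Rightarrow> bool" where
  "conley_attractor F A \<longleftrightarrow> compact A \<and> (\<exists>U. attracts_nbhd F A U)"

definition basin :: "('a::metric_space \<Rightarrow> 'a) set \<Rightarrow> 'a set \<Rightarrow> 'a set" where
  "basin F A = \<Union>{U. attracts_nbhd F A U}"

definition dual_repeller :: "('a::metric_space \<Rightarrow> 'a) set \<Rightarrow> 'a set \<Rightarrow> 'a set" where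
  "dual_repeller F A = UNIV - basin F A"

(* Only the values x 0, ..., x n matter. *)
definition eps_chain ::
    "('a::metric_space \<Rightarrow> 'a) set \<Rightarrow> real \<Rightarrow> nat \<Rightarrow> (nat \<Rightarrow> 'a) \<Rightarrow> bool" where
  "eps_chain F \<epsilon> n x \<longleftrightarrow> n > 0 \<and> (\<forall>i<n. \<exists>f\<in>F. dist (x (Suc i)) (f (x i)) < \<epsilon>)"

definition chain_recurrent :: "('a::metric_space \<Rightarrow> 'a) set \<Rightarrow> 'a \<Rightarrow> bool" where
  "chain_recurrent F p \<longleftrightarrow> (\<forall>\<epsilon>>0. \<exists>n x. eps_chain F \<epsilon> n x \<and> x 0 = p \<and> x n = p)"

end

(* A point p of the basin of an attractor A but outside A is not chain-recurrent: some fixed iterate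
   sends the closure of a neighbourhood U of p into an open set V with A <= V <= U and p outside V,
   and chains of that length with small jumps still end in V. Following a closed chain at p
   periodically, one would find p in V.
   Conversely, if no eps-chain leads from p to itself, then the set U of points reachable from p by
   eps-chains is open, misses p, and is a trapping region: F maps its closure into U. Hence the
   intersection A of the iterates of the closure of U is an attractor missing p. Every f maps p
   into U, so a small ball around p can be added to U, which puts p in the basin of A. *)
theory Submission
  imports Defs
begin

section \<open>Iterates of the set map\<close>

lemma ifs_map_mono: "S \<subseteq> T \<Longrightarrow> ifs_map F S \<subseteq> ifs_map F T"
  by (auto simp: ifs_map_def)

lemma funpow_ifs_map_mono: "S \<subseteq> T \<Longrightarrow> (ifs_map F ^^ k) S \<subseteq> (ifs_map F ^^ k) T"
  by (induction k) (auto intro!: ifs_map_mono)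

text \<open>By continuity, only the points of \<open>S\<close> itself have to be controlled. This is
  how a ball is later added to a trapping region.\<close>

lemma ifs_map_closure_trap:
  assumes "ifs F" "ifs_map F S \<subseteq> C" "closed C"
  shows "ifs_map F (closure S) \<subseteq> C"
proof -
  have "f ` closure S \<subseteq> C" if "f \<in> F" for f
  proof (rule image_closure_subset)
    show "continuous_on (closure S) f"
      using assms(1) that continuous_on_subset unfolding ifs_def by blast
    show "f ` S \<subseteq> C" using assms(2) that by (auto simp: ifs_map_def)
  qed (rule assms(3))
  then show ?thesis by (auto simp: ifs_map_def)
qed

lemma compact_funpow_ifs_map:
  assumes "ifs F" "compact S"
  shows "compact ((ifs_map F ^^ k) S)"
proof (induction k)
  case (Suc k)
  have "compact (f ` (ifs_map F ^^ k) S)" if "f \<in> F" for f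
    using Suc assms(1) that continuous_on_subset
    by (intro compact_continuous_image) (auto simp: ifs_def)
  then have "compact (ifs_map F ((ifs_map F ^^ k) S))"
    using assms(1) unfolding ifs_map_def[of F "(ifs_map F ^^ k) S"]
    by (intro compact_UN) (auto simp: ifs_def)
  then show ?case by simp
qed (use assms in simp)

section \<open>Compactness and Hausdorff limits\<close>

lemma decseq_compact_eventually_subset:
  fixes C :: "nat \<Rightarrow> 'a::metric_space set"
  assumes "\<And>n. compact (C n)" "decseq C" "(\<Inter>n. C n) \<subseteq> V" "open V"
  shows "\<forall>\<^sub>F n in sequentially. C n \<subseteq> V"
proof -
  have "compact (C 0 - V)" using assms(1,4) by (rule compact_diff)
  moreover have "open (- C n)" for n using assms(1) by (simp add: compact_imp_closed open_Compl)
  moreover have "C 0 - V \<subseteq> (\<Union>n. - C n)" using assms(3) by auto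
  ultimately obtain I where I: "finite I" "C 0 - V \<subseteq> (\<Union>n\<in>I. - C n)"
    using compactE_image[of "C 0 - V" UNIV "\<lambda>n. - C n"] by auto
  \<comment> \<open>Monotonicity replaces the finite subcover by one index. Inserting 0 keeps
    \<open>Max\<close> defined and gives \<open>C N \<subseteq> C 0\<close>, where the cover is
    available.\<close>
  define N where "N = Max (insert 0 I)"
  have "C N \<subseteq> C n" if "n \<in> insert 0 I" for n
    using assms(2) Max_ge[of "insert 0 I" n] that I(1) unfolding decseq_def N_def by blast
  then have "C N \<subseteq> V" using I(2) by blast
  then show ?thesis
    using assms(2) unfolding eventually_sequentially decseq_def by blast
qed

text \<open>A real \<open>SUP\<close> dominates its members only if these are bounded above; this
  provides the bound for the suprema in \<open>hausdorff_dist\<close>.\<close>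

lemma bdd_above_infdist_image:
  assumes "bounded (UNIV :: 'a::metric_space set)"
  shows "bdd_above ((\<lambda>x::'a. infdist x T) ` S)"
proof (cases "T = {}")
  case False
  then obtain t where t: "t \<in> T" by auto
  obtain e where "dist t y \<le> e" for y using assms unfolding bounded_any_center[of _ t] by auto
  then have "infdist x T \<le> e" for x
    using infdist_le[OF t] by (metis dist_commute order_trans)
  then show ?thesis by (intro bdd_aboveI2)
qed (auto simp: infdist_def)

text \<open>Since \<open>A\<close> lies in every \<open>S k\<close>, one of the two suprema in
  \<open>hausdorff_dist\<close> is 0. The other is small once \<open>S k\<close> lies in a thin
  neighbourhood of \<open>A\<close>. For empty \<open>A\<close>, taking \<open>V\<close> empty gives
  eventual emptiness.\<close>

lemma hausdorff_limit_squeeze: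
  assumes "\<And>k. A \<subseteq> S k" "\<And>V. open V \<Longrightarrow> A \<subseteq> V \<Longrightarrow> \<forall>\<^sub>F k in sequentially. S k \<subseteq> V"
  shows "hausdorff_limit S A"
proof (cases "A = {}")
  case True
  then show ?thesis using assms(2)[of "{}"] by (simp add: hausdorff_limit_def)
next
  case False
  have ne: "S k \<noteq> {}" for k using assms(1) False by auto
  have "(\<lambda>k. hausdorff_dist (S k) A) \<longlonglongrightarrow> 0"
  proof (rule tendstoI)
    fix e :: real
    assume "e > 0"
    \<comment> \<open>Radius \<open>e/2\<close>, because passing to the supremum weakens the strict
      bound to \<open>\<le>\<close>.\<close>
    have "open (\<Union>a\<in>A. ball a (e/2))" by auto
    moreover have "A \<subseteq> (\<Union>a\<in>A. ball a (e/2))" using \<open>e > 0\<close> by auto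
    ultimately have "\<forall>\<^sub>F k in sequentially. S k \<subseteq> (\<Union>a\<in>A. ball a (e/2))"
      by (rule assms(2))
    then show "\<forall>\<^sub>F k in sequentially. dist (hausdorff_dist (S k) A) 0 < e"
    proof (rule eventually_mono)
      fix k
      assume k: "S k \<subseteq> (\<Union>a\<in>A. ball a (e/2))"
      have "infdist x A \<le> e/2" if "x \<in> S k" for x
      proof -
        from subsetD[OF k that] obtain a where a: "a \<in> A" "dist a x < e/2" by (auto simp: mem_ball)
        show ?thesis using infdist_le[OF a(1), of x] a(2) by (simp add: dist_commute)
      qed
      then have 1: "(SUP x\<in>S k. infdist x A) \<le> e/2" by (intro cSUP_least ne)
      have "infdist y (S k) = 0" if "y \<in> A" for y
        using that assms(1) by (auto intro: infdist_zero)
      then have 2: "(SUP y\<in>A. infdist y (S k)) = 0" using False by simp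
      show "dist (hausdorff_dist (S k) A) 0 < e"
        using 1 2 \<open>e > 0\<close> by (simp add: hausdorff_dist_def)
    qed
  qed
  then show ?thesis using False ne by (simp add: hausdorff_limit_def)
qed

text \<open>A compact subset of an open set has a uniform margin \<open>e\<close> inside it, so
  every set at Hausdorff distance less than \<open>e\<close> from \<open>A\<close> stays in
  \<open>V\<close>.\<close>

lemma hausdorff_limit_eventually_subset:
  fixes A :: "'a::metric_space set"
  assumes "bounded (UNIV :: 'a set)" "hausdorff_limit S A" "compact A" "open V" "A \<subseteq> V"
  shows "\<forall>\<^sub>F k in sequentially. S k \<subseteq> V"
proof (cases "A = {}")
  case True
  then show ?thesis using assms(2) by (auto simp: hausdorff_limit_def elim: eventually_mono)
next
  case False
  obtain e where e: "e > 0" "(\<Union>a\<in>A. ball a e) \<subseteq> V"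
    using compact_subset_open_imp_ball_epsilon_subset[OF assms(3-5)] by blast
  have "(\<lambda>k. hausdorff_dist (S k) A) \<longlonglongrightarrow> 0"
    using assms(2) False by (simp add: hausdorff_limit_def)
  then have "\<forall>\<^sub>F k in sequentially. hausdorff_dist (S k) A < e"
    using e(1) by (rule order_tendstoD)
  then show ?thesis
  proof (rule eventually_mono)
    fix k
    assume k: "hausdorff_dist (S k) A < e"
    show "S k \<subseteq> V"
    proof
      fix x
      assume x: "x \<in> S k"
      have "infdist x A \<le> (SUP x\<in>S k. infdist x A)"
        by (rule cSUP_upper[OF x bdd_above_infdist_image[OF assms(1)]])
      also have "\<dots> < e" using k by (simp add: hausdorff_dist_def)
      finally have "infdist x A < e" .
      then obtain a where a: "a \<in> A" "dist x a < e"
        using False cINF_less_iff[OF False bdd_below_image_dist, of x e] by (auto simp: infdist_def)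
      then have "x \<in> ball a e" by (simp add: dist_commute)
      then show "x \<in> V" using a(1) e(2) by blast
    qed
  qed
qed

section \<open>Chain-recurrent points of a basin lie in the attractor\<close>

lemma ifs_uniformly_continuous:
  fixes F :: "('a::metric_space \<Rightarrow> 'a) set"
  assumes "compact (UNIV :: 'a set)" "ifs F" "\<epsilon> > 0"
  obtains \<delta> where "\<delta> > 0" "\<And>f x y. f \<in> F \<Longrightarrow> dist x y < \<delta> \<Longrightarrow> dist (f x) (f y) < \<epsilon>"
proof -
  have "\<exists>\<delta>>0. \<forall>x y. dist x y < \<delta> \<longrightarrow> dist (f x) (f y) < \<epsilon>" if "f \<in> F" for f
  proof -
    have "uniformly_continuous_on UNIV f"
      using assms that by (intro compact_uniformly_continuous) (auto simp: ifs_def)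
    then show ?thesis using assms(3) unfolding uniformly_continuous_on_def
      by (metis UNIV_I)
  qed
  then obtain d where d: "\<And>f. f \<in> F \<Longrightarrow> d f > (0::real)"
    "\<And>f x y. f \<in> F \<Longrightarrow> dist x y < d f \<Longrightarrow> dist (f x) (f y) < \<epsilon>"
    by metis
  have fin: "finite F" using assms(2) by (simp add: ifs_def)
  show thesis
  proof (rule that)
    \<comment> \<open>The 1 keeps \<open>Min\<close> defined when \<open>F\<close> is empty.\<close>
    show "Min (insert 1 (d ` F)) > 0" using fin d(1) by simp
    show "dist (f x) (f y) < \<epsilon>" if "f \<in> F" "dist x y < Min (insert 1 (d ` F))" for f x y
      using that fin d(2) by simp
  qed
qed

text \<open>Induction on the fixed length \<open>K\<close> for all \<delta> at once: half of
  \<delta> pays for the last jump, the other half for the image of the error made so far, which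
  uniform continuity keeps small. \<open>eps_chain\<close> is avoided so that \<open>K = 0\<close>
  is allowed.\<close>

lemma chain_shadowing:
  fixes F :: "('a::metric_space \<Rightarrow> 'a) set"
  assumes "compact (UNIV :: 'a set)" "ifs F" "\<delta> > 0"
  shows "\<exists>\<epsilon>>0. \<forall>x. (\<forall>i<K. \<exists>f\<in>F. dist (x (Suc i)) (f (x i)) < \<epsilon>) \<longrightarrow>
           (\<exists>y\<in>(ifs_map F ^^ K) {x 0}. dist (x K) y < \<delta>)"
  using assms(3)
proof (induction K arbitrary: \<delta>)
  case 0
  then show ?case by auto
next
  case (Suc K)
  obtain \<eta> where \<eta>: "\<eta> > 0" "\<And>f x y. f \<in> F \<Longrightarrow> dist x y < \<eta> \<Longrightarrow> dist (f x) (f y) < \<delta>/2"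
    using ifs_uniformly_continuous[OF assms(1,2), of "\<delta>/2"] Suc.prems by auto
  obtain \<epsilon> where \<epsilon>: "\<epsilon> > 0" "\<And>x. \<forall>i<K. \<exists>f\<in>F. dist (x (Suc i)) (f (x i)) < \<epsilon> \<Longrightarrow>
      \<exists>y\<in>(ifs_map F ^^ K) {x 0}. dist (x K) y < \<eta>"
    using Suc.IH[OF \<eta>(1)] by blast
  show ?case
  proof (intro exI[of _ "min \<epsilon> (\<delta>/2)"] conjI allI impI)
    show "min \<epsilon> (\<delta>/2) > 0" using \<epsilon>(1) Suc.prems by simp
    fix x
    assume x: "\<forall>i<Suc K. \<exists>f\<in>F. dist (x (Suc i)) (f (x i)) < min \<epsilon> (\<delta>/2)"
    then have "\<forall>i<K. \<exists>f\<in>F. dist (x (Suc i)) (f (x i)) < \<epsilon>" by (meson less_SucI min_less_iff_conj)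
    then obtain y where y: "y \<in> (ifs_map F ^^ K) {x 0}" "dist (x K) y < \<eta>"
      using \<epsilon>(2) by blast
    obtain f where f: "f \<in> F" "dist (x (Suc K)) (f (x K)) < \<delta>/2" using x by auto
    have "dist (x (Suc K)) (f y) < \<delta>"
      using f(2) \<eta>(2)[OF f(1) y(2)] dist_triangle[of "x (Suc K)" "f y" "f (x K)"] by linarith
    moreover have "f y \<in> (ifs_map F ^^ Suc K) {x 0}"
      using f(1) y(1) by (auto simp: ifs_map_def)
    ultimately show "\<exists>y\<in>(ifs_map F ^^ Suc K) {x 0}. dist (x (Suc K)) y < \<delta>" by blast
  qed
qed

lemma chain_recurrent_in_basin:
  fixes F :: "('a::metric_space \<Rightarrow> 'a) set"
  assumes X: "compact (UNIV :: 'a set)" and F: "ifs F" and A: "compact A"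
    and U: "attracts_nbhd F A U" and p: "p \<in> U" "chain_recurrent F p"
  shows "p \<in> A"
proof (rule ccontr)
  assume "p \<notin> A"
  \<comment> \<open>Removing \<open>p\<close> leaves an open neighbourhood of \<open>A\<close>, and
    a return to \<open>p\<close> becomes an exit from \<open>V\<close>.\<close>
  define V where "V = U - {p}"
  have V: "open V" "A \<subseteq> V"
    using U \<open>p \<notin> A\<close> by (auto simp: V_def attracts_nbhd_def)
  have cU: "compact (closure U)" using compact_Int_closed[OF X, of "closure U"] by simp
  have "\<forall>\<^sub>F k in sequentially. (ifs_map F ^^ k) (closure U) \<subseteq> V"
    using hausdorff_limit_eventually_subset[OF compact_imp_bounded[OF X] _ A V] U
    by (simp add: attracts_nbhd_def)
  then obtain K where K: "(ifs_map F ^^ K) (closure U) \<subseteq> V"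
    by (auto simp: eventually_sequentially)
  obtain \<delta> where \<delta>: "\<delta> > 0" "(\<Union>a\<in>(ifs_map F ^^ K) (closure U). ball a \<delta>) \<subseteq> V"
    using compact_subset_open_imp_ball_epsilon_subset
      [OF compact_funpow_ifs_map[OF F cU] V(1) K] by blast
  obtain \<epsilon> where \<epsilon>: "\<epsilon> > 0" "\<And>x. \<forall>i<K. \<exists>f\<in>F. dist (x (Suc i)) (f (x i)) < \<epsilon> \<Longrightarrow>
      \<exists>y\<in>(ifs_map F ^^ K) {x 0}. dist (x K) y < \<delta>"
    using chain_shadowing[OF X F \<delta>(1), of K] by blast
  obtain n c where c: "eps_chain F \<epsilon> n c" "c 0 = p" "c n = p"
    using p(2) \<epsilon>(1) by (auto simp: chain_recurrent_def)
  \<comment> \<open>Periodic continuation of the closed chain; \<open>c 0 = c n\<close> makes the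
    jump at the wrap-around legitimate.\<close>
  define d where "d i = c (i mod n)" for i
  have n: "n > 0" using c(1) by (simp add: eps_chain_def)
  have d: "\<exists>f\<in>F. dist (d (Suc i)) (f (d i)) < \<epsilon>" for i
  proof -
    have "d (Suc i) = c (Suc (i mod n))"
      using c(2,3) by (simp add: d_def mod_Suc)
    moreover have "i mod n < n" using n by simp
    ultimately show ?thesis using c(1) by (simp add: d_def eps_chain_def)
  qed
  have step: "d (m + K) \<in> V" if m: "d m \<in> closure U" for m
  proof -
    have "\<exists>y\<in>(ifs_map F ^^ K) {d m}. dist (d (m + K)) y < \<delta>"
      using \<epsilon>(2)[of "\<lambda>i. d (m + i)"] d by simp
    then obtain y where y: "y \<in> (ifs_map F ^^ K) {d m}" "dist (d (m + K)) y < \<delta>" by blast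
    have "y \<in> (ifs_map F ^^ K) (closure U)"
      using y(1) funpow_ifs_map_mono[of "{d m}" "closure U" K F] m by auto
    moreover have "d (m + K) \<in> ball y \<delta>" using y(2) by (simp add: dist_commute)
    ultimately show ?thesis using \<delta>(2) by blast
  qed
  have VU: "V \<subseteq> closure U" using closure_subset by (auto simp: V_def)
  have "d (j * K) \<in> closure U" for j
  proof (induction j)
    case 0
    then show ?case using p(1) c(2) closure_subset by (auto simp: d_def)
  next
    case (Suc j)
    then have "d (j * K + K) \<in> closure U" using step VU by blast
    then show ?case by (simp add: add.commute)
  qed
  \<comment> \<open>The induction yields only \<open>closure U\<close>; one more block of
    \<open>K\<close> jumps reaches \<open>V\<close>. The final time \<open>n * K\<close> is a
    multiple of the period, where \<open>d\<close> equals \<open>p\<close>.\<close>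
  then have "d ((n - 1) * K + K) \<in> V" by (rule step)
  also have "(n - 1) * K + K = n * K" using n by (cases n) auto
  finally show False using c(2) by (simp add: d_def V_def)
qed

section \<open>Attractors from sets of reachable points\<close>

lemma eps_chain_update_last:
  assumes "eps_chain F \<epsilon> n c" "f \<in> F" "dist y (f (c (n - 1))) < \<epsilon>"
  shows "eps_chain F \<epsilon> n (c(n := y))"
  using assms by (auto simp: eps_chain_def less_Suc_eq_le dest: spec[of _ "n - 1"])

lemma eps_chain_extend:
  assumes "eps_chain F \<epsilon> n c" "f \<in> F" "dist y (f (c n)) < \<epsilon>"
  shows "eps_chain F \<epsilon> (Suc n) (c(Suc n := y))"
  using assms by (auto simp: eps_chain_def less_Suc_eq)

text \<open>The last jump is strictly shorter than \<epsilon>, so the endpoint of a chain can be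
  moved within the remaining slack.\<close>

lemma open_reachable:
  "open {y. \<exists>n c. eps_chain F \<epsilon> n c \<and> c 0 = p \<and> c n = y}" (is "open ?U")
  unfolding open_dist
proof
  fix y
  assume "y \<in> ?U"
  then obtain n c where c: "eps_chain F \<epsilon> n c" "c 0 = p" "c n = y" by auto
  have n: "n > 0" using c(1) by (simp add: eps_chain_def)
  then have "\<exists>f\<in>F. dist (c (Suc (n - 1))) (f (c (n - 1))) < \<epsilon>"
    using c(1) unfolding eps_chain_def by (metis diff_less zero_less_one)
  then obtain f where f: "f \<in> F" "dist y (f (c (n - 1))) < \<epsilon>" using n c(3) by auto
  have "z \<in> ?U" if "dist z y < \<epsilon> - dist y (f (c (n - 1)))" for z
  proof -
    have "dist z (f (c (n - 1))) < \<epsilon>"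
      using that dist_triangle[of z "f (c (n - 1))" y] by linarith
    then have "eps_chain F \<epsilon> n (c(n := z))" using eps_chain_update_last c(1) f(1) by blast
    then show ?thesis using n c(2) by (auto intro!: exI[of _ n] exI[of _ "c(n := z)"])
  qed
  then show "\<exists>e>0. \<forall>z. dist z y < e \<longrightarrow> z \<in> ?U"
    using f(2) by (intro exI[of _ "\<epsilon> - dist y (f (c (n - 1)))"]) auto
qed

text \<open>\<open>W\<close> may exceed the trapping region \<open>U\<close>, so that the basin can
  contain points outside \<open>U\<close>. One application of the set map brings
  \<open>closure W\<close> into \<open>closure U\<close>, so both sequences of iterates shrink to
  the same intersection.\<close>

lemma trapping_region_attractor:
  fixes F :: "('a::metric_space \<Rightarrow> 'a) set"
  assumes X: "compact (UNIV :: 'a set)" and F: "ifs F"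
    and U: "ifs_map F (closure U) \<subseteq> U"
    and W: "open W" "U \<subseteq> W" "ifs_map F (closure W) \<subseteq> closure U"
  shows "attracts_nbhd F (\<Inter>k. (ifs_map F ^^ k) (closure U)) W"
proof -
  define C where "C k = (ifs_map F ^^ k) (closure U)" for k
  have cU: "compact (closure U)" using compact_Int_closed[OF X, of "closure U"] by simp
  have comp: "compact (C k)" for k unfolding C_def by (rule compact_funpow_ifs_map[OF F cU])
  have "C (Suc k) \<subseteq> C k" for k
    using funpow_ifs_map_mono[of "ifs_map F (closure U)" "closure U" k F] U closure_subset[of U]
    unfolding C_def funpow_Suc_right by auto
  then have dec: "decseq C" by (intro decseq_SucI)
  have "hausdorff_limit (\<lambda>k. (ifs_map F ^^ k) (closure W)) (\<Inter>k. C k)"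
  proof (rule hausdorff_limit_squeeze)
    show "(\<Inter>k. C k) \<subseteq> (ifs_map F ^^ k) (closure W)" for k
      using funpow_ifs_map_mono[OF closure_mono[OF W(2)], where F = F and k = k] by (auto simp: C_def)
    fix V :: "'a set"
    assume "open V" "(\<Inter>k. C k) \<subseteq> V"
    then have "\<forall>\<^sub>F k in sequentially. C k \<subseteq> V"
      using decseq_compact_eventually_subset[OF comp dec] by blast
    \<comment> \<open>The iterates of \<open>closure W\<close> lag one step behind the sets
      \<open>C k\<close>.\<close>
    moreover have "(ifs_map F ^^ Suc k) (closure W) \<subseteq> C k" for k
      using funpow_ifs_map_mono[OF W(3), where F = F and k = k] unfolding C_def funpow_Suc_right by simp
    ultimately have "\<forall>\<^sub>F k in sequentially. (ifs_map F ^^ Suc k) (closure W) \<subseteq> V"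
      by (elim eventually_mono) blast
    then show "\<forall>\<^sub>F k in sequentially. (ifs_map F ^^ k) (closure W) \<subseteq> V"
      using eventually_sequentially_Suc[of "\<lambda>k. (ifs_map F ^^ k) (closure W) \<subseteq> V"] by blast
  qed
  moreover have "(\<Inter>k. C k) \<subseteq> W"
  proof -
    have "(\<Inter>k. C k) \<subseteq> C 1" by blast
    also have "\<dots> \<subseteq> W" using U W(2) by (auto simp: C_def)
    finally show ?thesis .
  qed
  ultimately show ?thesis using W(1) by (simp add: attracts_nbhd_def C_def)
qed

lemma not_chain_recurrent_in_basin:
  fixes F :: "('a::metric_space \<Rightarrow> 'a) set"
  assumes X: "compact (UNIV :: 'a set)" and F: "ifs F" and p: "\<not> chain_recurrent F p"
  obtains A where "conley_attractor F A" "p \<in> basin F A" "p \<notin> A"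
proof -
  obtain \<epsilon> where \<epsilon>: "\<epsilon> > 0" "\<And>n c. \<not> (eps_chain F \<epsilon> n c \<and> c 0 = p \<and> c n = p)"
    using p by (auto simp: chain_recurrent_def)
  define U where "U = {y. \<exists>n c. eps_chain F \<epsilon> n c \<and> c 0 = p \<and> c n = y}"
  have opU: "open U" unfolding U_def by (rule open_reachable)
  have pU: "p \<notin> U" using \<epsilon>(2) by (auto simp: U_def)
  obtain \<delta> where \<delta>: "\<delta> > 0" "\<And>f x y. f \<in> F \<Longrightarrow> dist x y < \<delta> \<Longrightarrow> dist (f x) (f y) < \<epsilon>"
    using ifs_uniformly_continuous[OF X F \<epsilon>(1)] by blast
  \<comment> \<open>A single jump from \<open>p\<close> suffices, as \<open>f y\<close> is within
    \<epsilon> of \<open>f p\<close>.\<close>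
  have near_p: "f y \<in> U" if "f \<in> F" "dist y p < \<delta>" for f y
  proof -
    have "eps_chain F \<epsilon> 1 (case_nat p (\<lambda>_. f y))"
      using \<delta>(2)[OF that] that(1) by (auto simp: eps_chain_def)
    then show ?thesis by (auto simp: U_def intro!: exI[of _ 1] exI[of _ "case_nat p (\<lambda>_. f y)"])
  qed
  have U: "ifs_map F (closure U) \<subseteq> U"
  proof -
    have "f y \<in> U" if "f \<in> F" "y \<in> closure U" for f y
    proof -
      \<comment> \<open>A chain ending at a reachable \<open>z\<close> close to \<open>y\<close> is
        prolonged by a jump to \<open>f y\<close>, which is within \<epsilon> of
        \<open>f z\<close>.\<close>
      obtain z where z: "z \<in> U" "dist z y < \<delta>"
        using \<open>y \<in> closure U\<close> \<delta>(1) by (auto simp: closure_approachable)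
      then obtain n c where c: "eps_chain F \<epsilon> n c" "c 0 = p" "c n = z" by (auto simp: U_def)
      have "dist (f y) (f (c n)) < \<epsilon>" using \<delta>(2) z(2) c(3) that(1) by (simp add: dist_commute)
      from eps_chain_extend[OF c(1) that(1) this] show ?thesis
        using c(2) by (auto simp: U_def intro!: exI[of _ "Suc n"] exI[of _ "c(Suc n := f y)"])
    qed
    then show ?thesis by (auto simp: ifs_map_def)
  qed
  define A where "A = (\<Inter>k. (ifs_map F ^^ k) (closure U))"
  define W where "W = U \<union> ball p \<delta>"
  have "ifs_map F W \<subseteq> closure U"
  proof -
    have "f y \<in> U" if "f \<in> F" "y \<in> W" for f y
    proof (cases "y \<in> U")
      case True
      then have "f y \<in> ifs_map F (closure U)"
        using that(1) closure_subset[of U] unfolding ifs_map_def by blast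
      then show ?thesis using U by blast
    next
      case False
      then show ?thesis using that near_p by (simp add: W_def dist_commute)
    qed
    then show ?thesis using closure_subset[of U] by (auto simp: ifs_map_def)
  qed
  then have W: "ifs_map F (closure W) \<subseteq> closure U"
    by (rule ifs_map_closure_trap[OF F]) simp
  have attr: "attracts_nbhd F A W"
    unfolding A_def by (rule trapping_region_attractor[OF X F U _ _ W]) (auto simp: W_def opU)
  have "closed ((ifs_map F ^^ k) (closure U))" for k
    using compact_funpow_ifs_map[OF F] compact_Int_closed[OF X, of "closure U"]
    by (simp add: compact_imp_closed)
  then have "closed A" unfolding A_def by (intro closed_INT) auto
  then have "compact A" using compact_Int_closed[OF X, of A] by simp
  then have "conley_attractor F A" using attr by (auto simp: conley_attractor_def)
  moreover have "p \<in> basin F A" using attr \<delta>(1) by (auto simp: basin_def W_def)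
  moreover have "p \<notin> A"
  proof
    assume "p \<in> A"
    \<comment> \<open>The index is 1 rather than 0: \<open>p\<close> may lie in
      \<open>closure U\<close>, but the first image lies in \<open>U\<close>.\<close>
    then have "p \<in> (ifs_map F ^^ 1) (closure U)" unfolding A_def by blast
    then show False using U pU by auto
  qed
  ultimately show thesis by (rule that)
qed

theorem theorem5p5:
  fixes F :: "('a::metric_space \<Rightarrow> 'a) set"
  assumes "compact (UNIV :: 'a set)"
    and "invertible_ifs F"
  shows "{x. chain_recurrent F x} = (\<Inter>A\<in>{A. conley_attractor F A}. A \<union> dual_repeller F A)"
proof -
  have F: "ifs F" using assms(2) by (simp add: invertible_ifs_def)
  \<comment> \<open>The basin is a union, so \<open>p\<close> lies in a single attracted
    neighbourhood \<open>U\<close>.\<close>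
  have "p \<in> A" if "chain_recurrent F p" "conley_attractor F A" "p \<in> basin F A" for p A
    using that chain_recurrent_in_basin[OF assms(1) F]
    by (auto simp: conley_attractor_def basin_def)
  moreover have "\<exists>A. conley_attractor F A \<and> p \<in> basin F A \<and> p \<notin> A" if "\<not> chain_recurrent F p" for p
    using not_chain_recurrent_in_basin[OF assms(1) F that] by blast
  ultimately show ?thesis unfolding dual_repeller_def by blast
qed

end
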